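(* There is an absolute constant $C_0$ such that the following holds. Let $a,b$ be positive integers and $\delta,\nu\in\mathbb{N}^{-1}$ with $\nu^a\delta^{-1},\nu^b\delta^{-1}\in\mathbb{N}$, and let $E>10^3$. Then $$\mathcal{M}_{1,a,b}(\delta,\nu,E)\le C_E\,\mathcal{M}_{2,b,a}(\delta,\nu,E/C_0)^{1/4}\,D(\delta/\nu^b)^{3/4},$$ where $C_E$ depends only on $E$.
   Context: Write $e(z)=e^{2\pi i z}$, $\gamma(\xi)=(\xi,\xi^2,\xi^3)$, and for an interval $J\subset[0,1]$ and $g:[0,1]\to\mathbb{C}$, $(\mathcal{E}_J g)(x)=\int_J g(\xi)e(x\cdot\gamma(\xi))d\xi$, $x\in\mathbb{R}^3$. For an interval $I$ and $\sigma>0$ with $|I|/\sigma\in\mathbb{N}$, $P_\sigma(I)$ is the partition of $I$ into intervals of length $\sigma$. For $\delta\in\mathbb{N}^{-1}$, $D(\delta)$ is the smallest constant with $\|\mathcal{E}_{[0,1]}g\|_{L^{12}(\mathbb{R}^3)}\le D(\delta)(\sum_{J\in P_\delta([0,1])}\|\mathcal{E}_Jg\|_{L^{12}(\mathbb{R}^3)}^4)^{1/4}$ for all $g$. For an interval $I\subset[0,1]$ with center $c_I$, let $\mathcal{T}_I=\{x\in\mathbb{R}^3:|x\cdot\gamma'(c_I)|\le|I|^{-1},|x\cdot\gamma''(c_I)|\le|I|^{-2},|x\cdot\gamma'''(c_I)|\le|I|^{-3}\}$. For a parallelepiped $T=A[0,1]^3+c$ ($A$ invertible) and $E>0$, $w_{T,E}(x)=(1+|A^{-1}(x-c)|)^{-E}$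 and $\phi_{T,E}(x)=|\det A|^{-1}w_{T,E}(x)$. For $\delta,\nu\in\mathbb{N}^{-1}$, $a,b\in\mathbb{N}$, $E>0$: $\mathcal{M}_{1,a,b}(\delta,\nu,E)$ is the smallest $M$ such that $$\int_{\mathbb{R}^3}\big(|\mathcal{E}_Ig|^2*\phi_{\mathcal{T}_I,E}\big)\big(|\mathcal{E}_{I'}g|^{10}*\phi_{\mathcal{T}_{I'},E}\big)\le M^{12}\Big(\sum_{J\in P_\delta(I)}\|\mathcal{E}_Jg\|_{L^{12}}^4\Big)^{1/2}\Big(\sum_{J'\in P_\delta(I')}\|\mathcal{E}_{J'}g\|_{L^{12}}^4\Big)^{5/2},$$ and $\mathcal{M}_{2,a,b}(\delta,\nu,E)$ is the smallest $M$ such that $$\int_{\mathbb{R}^3}\big(|\mathcal{E}_Ig|^4*\phi_{\mathcal{T}_I,E}\big)\big(|\mathcal{E}_{I'}g|^{8}*\phi_{\mathcal{T}_{I'},E}\big)\le M^{12}\Big(\sum_{J\in P_\delta(I)}\|\mathcal{E}_Jg\|_{L^{12}}^4\Big)\Big(\sum_{J'\in P_\delta(I')}\|\mathcal{E}_{J'}g\|_{L^{12}}^4\Big)^{2},$$ each for all $g:[0,1]\to\mathbb{C}$ and all $I\in P_{\nu^a}([0,1])$, $I'\in P_{\nu^b}([0,1])$ with $\mathrm{dist}(I,I')\ge\nu$ (all $L^{12}$ norms over $\mathbb{R}^3$). *)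

theory Defs
  imports "HOL-Analysis.Analysis"
begin

text \<open>Real power on [0,\<infinity>]: x^p for p > 0, with \<infinity>^p = \<infinity>.\<close>
definition enn_powr :: "real \<Rightarrow> ennreal \<Rightarrow> ennreal" where
  "enn_powr p x = (if x = \<infinity> then \<infinity> else ennreal (enn2real x powr p))"

text \<open>e(z) = exp(2 pi i z)\<close>
definition e :: "real \<Rightarrow> complex" where
  "e z = exp (2 * pi * \<i> * complex_of_real z)"

text \<open>moment curve gamma(xi) = (xi, xi^2, xi^3)\<close>
definition gam :: "real \<Rightarrow> real^3" where
  "gam \<xi> = vector [\<xi>, \<xi>^2, \<xi>^3]"

text \<open>Extension operator (E_J g)(x) = int_J g(xi) e(x . gamma(xi)) dxi\<close>
definition ext :: "real set \<Rightarrow> (real \<Rightarrow> complex) \<Rightarrow> real^3 \<Rightarrow> complex" where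
  "ext J g x = (LINT \<xi>:J|lborel. g \<xi> * e (x \<bullet> gam \<xi>))"

text \<open>L^12 norm over R^3 (possibly infinite)\<close>
definition L12 :: "(real^3 \<Rightarrow> complex) \<Rightarrow> ennreal" where
  "L12 f = enn_powr (1/12) (\<integral>\<^sup>+ x. ennreal (cmod (f x) ^ 12) \<partial>lborel)"

text \<open>P_sigma([l,r]): partition of [l,r] into intervals of length sigma
  (used only when (r-l)/sigma is a natural number)\<close>
definition part :: "real \<Rightarrow> real \<Rightarrow> real \<Rightarrow> real set set" where
  "part \<sigma> l r = {{l + real k * \<sigma> .. l + (real k + 1) * \<sigma>} | k. k < nat \<lfloor>(r - l) / \<sigma>\<rfloor>}"

text \<open>N^{-1} = {1/n : n a positive integer}\<close>
definition Ninv :: "real set" where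
  "Ninv = {1 / real n | n. n \<ge> 1}"

text \<open>Weights: for T = A[0,1]^3 + c, w_{T,E}(x) = (1+|A^{-1}(x-c)|)^{-E}, phi = |det A|^{-1} w\<close>
definition wT :: "real^3^3 \<Rightarrow> real^3 \<Rightarrow> real \<Rightarrow> real^3 \<Rightarrow> real" where
  "wT A c E x = (1 + norm (matrix_inv A *v (x - c))) powr (- E)"

definition phiT :: "real^3^3 \<Rightarrow> real^3 \<Rightarrow> real \<Rightarrow> real^3 \<Rightarrow> real" where
  "phiT A c E x = wT A c E x / \<bar>det A\<bar>"

text \<open>For an interval I with centre c and length L, T_I = {x. |M_I x|_inf <= 1} where the rows
  of M_I are L gamma'(c), L^2 gamma''(c), L^3 gamma'''(c).  Hence
  T_I = A_I [0,1]^3 + c_I with A_I = 2 M_I^{-1} and c_I = - M_I^{-1} (1,1,1).\<close>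
definition MT :: "real set \<Rightarrow> real^3^3" where
  "MT I = (let c = (Inf I + Sup I) / 2; L = Sup I - Inf I in
     vector [vector [L, L * 2 * c, L * 3 * c^2],
             vector [0, L^2 * 2, L^2 * 6 * c],
             vector [0, 0, L^3 * 6]])"

definition TA :: "real set \<Rightarrow> real^3^3" where
  "TA I = (2::real) *\<^sub>R matrix_inv (MT I)"

definition Tc :: "real set \<Rightarrow> real^3" where
  "Tc I = - (matrix_inv (MT I) *v vector [1, 1, 1])"

text \<open>(|f|^p * phi_{T_I,E})(x)\<close>
definition convI :: "(real^3 \<Rightarrow> complex) \<Rightarrow> nat \<Rightarrow> real set \<Rightarrow> real \<Rightarrow> real^3 \<Rightarrow> ennreal" where
  "convI f p I E x = (\<integral>\<^sup>+ y. ennreal (cmod (f (x - y)) ^ p * phiT (TA I) (Tc I) E y) \<partial>lborel)"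

text \<open>Admissible g: integrable on [0,1]\<close>
definition g_ok :: "(real \<Rightarrow> complex) \<Rightarrow> bool" where
  "g_ok g = set_integrable lborel {0..1} g"

definition Dec :: "real \<Rightarrow> ennreal" where
  "Dec \<delta> = Inf {D. \<forall>g. g_ok g \<longrightarrow>
      L12 (ext {0..1} g) \<le> D * enn_powr (1/4) (\<Sum>J\<in>part \<delta> 0 1. L12 (ext J g) ^ 4)}"

definition M1 :: "nat \<Rightarrow> nat \<Rightarrow> real \<Rightarrow> real \<Rightarrow> real \<Rightarrow> ennreal" where
  "M1 a b \<delta> \<nu> E = Inf {M. \<forall>g. g_ok g \<longrightarrow>
      (\<forall>I\<in>part (\<nu>^a) 0 1. \<forall>I'\<in>part (\<nu>^b) 0 1. setdist I I' \<ge> \<nu> \<longrightarrow>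
        (\<integral>\<^sup>+ x. convI (ext I g) 2 I E x * convI (ext I' g) 10 I' E x \<partial>lborel)
        \<le> M ^ 12 * enn_powr (1/2) (\<Sum>J\<in>part \<delta> (Inf I) (Sup I). L12 (ext J g) ^ 4)
                 * enn_powr (5/2) (\<Sum>J'\<in>part \<delta> (Inf I') (Sup I'). L12 (ext J' g) ^ 4))}"

definition M2 :: "nat \<Rightarrow> nat \<Rightarrow> real \<Rightarrow> real \<Rightarrow> real \<Rightarrow> ennreal" where
  "M2 a b \<delta> \<nu> E = Inf {M. \<forall>g. g_ok g \<longrightarrow>
      (\<forall>I\<in>part (\<nu>^a) 0 1. \<forall>I'\<in>part (\<nu>^b) 0 1. setdist I I' \<ge> \<nu> \<longrightarrow>
        (\<integral>\<^sup>+ x. convI (ext I g) 4 I E x * convI (ext I' g) 8 I' E x \<partial>lborel)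
        \<le> M ^ 12 * (\<Sum>J\<in>part \<delta> (Inf I) (Sup I). L12 (ext J g) ^ 4)
                 * (\<Sum>J'\<in>part \<delta> (Inf I') (Sup I'). L12 (ext J' g) ^ 4) ^ 2)}"

end

theory Submission
  imports Defs
begin

text \<open>
  Write \<open>F = \<E>\<^sub>I g\<close>, \<open>G = \<E>\<^sub>I\<^sub>' g\<close> and \<open>\<phi>, \<phi>'\<close> for the two weights. Since
  \<open>\<bar>F\<bar>\<^sup>2 \<phi> = (\<bar>F\<bar>\<^sup>8 \<phi>)\<^bsup>1/4\<^esup> \<phi>\<^bsup>3/4\<^esup>\<close> and \<open>\<bar>G\<bar>\<^sup>1\<^sup>0 \<phi>' = (\<bar>G\<bar>\<^sup>4 \<phi>')\<^bsup>1/4\<^esup> (\<bar>G\<bar>\<^sup>1\<^sup>2 \<phi>')\<^bsup>3/4\<^esup>\<close>,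
  Holder's inequality with exponents \<open>(4, 4/3)\<close>, applied inside both convolutions and once more
  in \<open>x\<close>, bounds the \<open>\<M>\<^sub>1\<close> integral by
  \<open>K\<^bsup>3/4\<^esup> (\<integral> (\<bar>G\<bar>\<^sup>4 * \<phi>') (\<bar>F\<bar>\<^sup>8 * \<phi>))\<^bsup>1/4\<^esup> (K \<parallel>G\<parallel>\<^sub>1\<^sub>2\<^sup>1\<^sup>2)\<^bsup>3/4\<^esup>\<close>,
  where \<open>K = \<integral> (1 + \<bar>z\<bar>)\<^bsup>-E\<^esup> dz\<close> is the common mass of all weights (finite for \<open>E \<ge> 6\<close>).
  The middle factor is the \<open>\<M>\<^sub>2\<close> integral with the roles of \<open>I\<close> and \<open>I'\<close> exchanged, and
  \<open>\<parallel>G\<parallel>\<^sub>1\<^sub>2\<close> is bounded by \<open>D(\<delta>/\<nu>\<^sup>b)\<close> after parabolic rescaling of \<open>I'\<close> to \<open>[0, 1]\<close>.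
  Hence the theorem holds with \<open>C\<^sub>0 = 1\<close> and \<open>C\<^sub>E = K\<^bsup>1/8\<^esup>\<close>.
\<close>

section \<open>Real powers of extended non-negative reals\<close>

lemma enn_powr_top [simp]: "enn_powr p top = top"
  by (simp add: enn_powr_def)

lemma enn_powr_ennreal [simp]: "0 \<le> r \<Longrightarrow> enn_powr p (ennreal r) = ennreal (r powr p)"
  by (simp add: enn_powr_def)

lemma enn_powr_0 [simp]: "enn_powr p 0 = 0"
  by (simp add: enn_powr_def)

lemma enn_powr_1 [simp]: "enn_powr 1 x = x"
  by (cases x rule: ennreal_cases) auto

lemma enn_powr_eq_0_iff [simp]: "p > 0 \<Longrightarrow> enn_powr p x = 0 \<longleftrightarrow> x = 0"
  by (cases x rule: ennreal_cases) auto

lemma enn_powr_eq_top_iff [simp]: "enn_powr p x = top \<longleftrightarrow> x = top"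
  by (cases x rule: ennreal_cases) auto

lemma enn_powr_mult:
  assumes "p > 0"
  shows "enn_powr p (x * y) = enn_powr p x * enn_powr p y"
proof (cases x rule: ennreal_cases; cases y rule: ennreal_cases)
  fix r s assume "x = ennreal r" "0 \<le> r" "y = ennreal s" "0 \<le> s"
  then show ?thesis by (simp add: ennreal_mult'[symmetric] powr_mult)
qed (use assms in \<open>auto simp: ennreal_mult_top ennreal_top_mult\<close>)

lemma enn_powr_add:
  assumes "p > 0" "q > 0"
  shows "enn_powr p x * enn_powr q x = enn_powr (p + q) x"
  using assms by (cases x rule: ennreal_cases) (auto simp: ennreal_mult'[symmetric] powr_add)

lemma enn_powr_enn_powr:
  assumes "p > 0" "q > 0"
  shows "enn_powr p (enn_powr q x) = enn_powr (p * q) x"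
  using assms by (cases x rule: ennreal_cases) (auto simp: powr_powr mult.commute)

lemma enn_powr_power:
  assumes "p > 0" "n > 0"
  shows "enn_powr p x ^ n = enn_powr (p * real n) x"
proof (cases x rule: ennreal_cases)
  case (real r)
  then show ?thesis
    using assms by (cases "r = 0") (auto simp: ennreal_power powr_power mult.commute)
qed (use assms in simp)

lemma enn_powr_of_nat:
  assumes "n > 0"
  shows "enn_powr (real n) x = x ^ n"
  using enn_powr_power[of 1 n x] assms by simp

lemma enn_powr_of_power:
  assumes "p > 0" "n > 0"
  shows "enn_powr p (x ^ n) = enn_powr (p * real n) x"
  using assms by (simp add: enn_powr_of_nat[symmetric] enn_powr_enn_powr)

lemma enn_powr_mono:
  assumes "x \<le> y" "0 \<le> p"
  shows "enn_powr p x \<le> enn_powr p y"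
proof (cases y rule: ennreal_cases)
  case (real s)
  with assms obtain r where "x = ennreal r" "0 \<le> r" "r \<le> s"
    by (cases x rule: ennreal_cases) (auto simp: top_unique)
  then show ?thesis using real assms by (auto intro!: ennreal_leI powr_mono2)
qed simp

lemma borel_measurable_enn_powr [measurable]:
  assumes [measurable]: "f \<in> borel_measurable M"
  shows "(\<lambda>x. enn_powr p (f x)) \<in> borel_measurable M"
proof -
  have "(\<lambda>x::ennreal. if x = top then top else ennreal (enn2real x powr p)) \<in> borel_measurable borel"
    by measurable
  then show ?thesis
    unfolding enn_powr_def infinity_ennreal_def by (rule measurable_compose[OF assms])
qed

section \<open>Holder's inequality for non-negative integrals\<close>

lemma ennreal_Young:
  fixes u v :: ennreal
  assumes \<theta>: "0 < \<theta>" "\<theta> < 1" and ab: "0 < a" "0 < b"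
  shows "enn_powr \<theta> u * enn_powr (1 - \<theta>) v
    \<le> ennreal (a powr \<theta> * b powr (1 - \<theta>)) * (ennreal (\<theta> / a) * u + ennreal ((1 - \<theta>) / b) * v)"
proof (cases u rule: ennreal_cases; cases v rule: ennreal_cases)
  fix s t assume u: "u = ennreal s" "0 \<le> s" and v: "v = ennreal t" "0 \<le> t"
  define c where "c = a powr \<theta> * b powr (1 - \<theta>)"
  have "s powr \<theta> * t powr (1 - \<theta>) \<le> c * (\<theta> / a * s + (1 - \<theta>) / b * t)"
  proof (cases "s = 0 \<or> t = 0")
    case False
    then have "(s / a) powr \<theta> * (t / b) powr (1 - \<theta>) \<le> \<theta> * (s / a) + (1 - \<theta>) * (t / b)"
      using u v \<theta> ab by (intro Youngs_inequality_0) auto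
    from mult_left_mono[OF this, of c] show ?thesis
      using u v ab by (simp add: c_def powr_divide)
  qed (use u v \<theta> ab in \<open>auto simp: c_def\<close>)
  then have "ennreal (s powr \<theta> * t powr (1 - \<theta>)) \<le> ennreal (c * (\<theta> / a * s + (1 - \<theta>) / b * t))"
    by (rule ennreal_leI)
  also have "\<dots> = ennreal c * (ennreal (\<theta> / a) * ennreal s + ennreal ((1 - \<theta>) / b) * ennreal t)"
    using u v \<theta> ab by (simp add: c_def ennreal_mult'[symmetric] ennreal_plus[symmetric] del: ennreal_plus)
  finally show ?thesis
    using u v by (simp add: c_def ennreal_mult'[symmetric])
qed (use \<theta> ab in \<open>auto simp: ennreal_mult_top ennreal_top_mult\<close>)

lemma nn_integral_Holder:
  assumes \<theta>: "0 < \<theta>" "\<theta> < 1"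
    and [measurable]: "f \<in> borel_measurable M" "h \<in> borel_measurable M"
  shows "(\<integral>\<^sup>+x. enn_powr \<theta> (f x) * enn_powr (1 - \<theta>) (h x) \<partial>M)
    \<le> enn_powr \<theta> (\<integral>\<^sup>+x. f x \<partial>M) * enn_powr (1 - \<theta>) (\<integral>\<^sup>+x. h x \<partial>M)"
proof -
  define F H where "F = (\<integral>\<^sup>+x. f x \<partial>M)" and "H = (\<integral>\<^sup>+x. h x \<partial>M)"
  consider "F = 0 \<or> H = 0" | "F = top \<or> H = top" "F \<noteq> 0" "H \<noteq> 0"
    | a b where "F = ennreal a" "0 < a" "H = ennreal b" "0 < b"
  proof (cases F rule: ennreal_cases; cases H rule: ennreal_cases)
    fix a b assume "F = ennreal a" "0 \<le> a" "H = ennreal b" "0 \<le> b"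
    then show thesis using that by (cases "a = 0 \<or> b = 0") auto
  qed (use that in auto)
  then show ?thesis
  proof cases
    case 1
    then have "AE x in M. enn_powr \<theta> (f x) * enn_powr (1 - \<theta>) (h x) = 0"
      using \<theta> by (auto simp: F_def H_def nn_integral_0_iff_AE)
    then have "(\<integral>\<^sup>+x. enn_powr \<theta> (f x) * enn_powr (1 - \<theta>) (h x) \<partial>M) = 0"
      by (simp add: nn_integral_0_iff_AE)
    then show ?thesis by simp
  next
    case 2
    then show ?thesis using \<theta> by (auto simp: F_def[symmetric] H_def[symmetric] ennreal_mult_top ennreal_top_mult)
  next
    case 3
    define c where "c = a powr \<theta> * b powr (1 - \<theta>)"
    have "(\<integral>\<^sup>+x. enn_powr \<theta> (f x) * enn_powr (1 - \<theta>) (h x) \<partial>M)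
        \<le> (\<integral>\<^sup>+x. ennreal c * (ennreal (\<theta> / a) * f x + ennreal ((1 - \<theta>) / b) * h x) \<partial>M)"
      using 3 \<theta> by (intro nn_integral_mono) (simp add: c_def ennreal_Young)
    also have "\<dots> = ennreal c * (ennreal (\<theta> / a) * F + ennreal ((1 - \<theta>) / b) * H)"
      by (simp add: nn_integral_add nn_integral_cmult F_def H_def)
    also have "\<dots> = enn_powr \<theta> F * enn_powr (1 - \<theta>) H"
      using 3 \<theta> by (simp add: c_def ennreal_mult'[symmetric] ennreal_plus[symmetric] field_simps
          del: ennreal_plus)
    finally show ?thesis by (simp add: F_def H_def)
  qed
qed

lemma le_Inf_power_mult:
  fixes S :: "ennreal set"
  assumes n: "n > 0" and Y: "0 < Y" "Y < top" and bound: "\<And>M. M \<in> S \<Longrightarrow> X \<le> M ^ n * Y"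
  shows "X \<le> Inf S ^ n * Y"
proof -
  define Z where "Z = X / Y"
  have X: "X = Z * Y"
    using Y by (simp add: Z_def ennreal_divide_times ennreal_times_divide less_top)
  have "enn_powr (1 / real n) Z \<le> Inf S"
  proof (rule Inf_greatest)
    fix M assume "M \<in> S"
    then have "Z \<le> M ^ n"
      using bound[of M] Y by (auto simp: Z_def mult.commute intro: divide_le_posI_ennreal)
    then have "enn_powr (1 / real n) Z \<le> enn_powr (1 / real n) (M ^ n)"
      by (rule enn_powr_mono) simp
    also have "\<dots> = M" using n by (simp add: enn_powr_of_power)
    finally show "enn_powr (1 / real n) Z \<le> M" .
  qed
  then have "enn_powr (1 / real n) Z ^ n \<le> Inf S ^ n" by (rule power_mono) simp
  then have "Z \<le> Inf S ^ n" using n by (simp add: enn_powr_power)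
  then show ?thesis by (simp add: X mult_right_mono)
qed

section \<open>Lebesgue integrals on Euclidean space\<close>

lemma matrix_inv_right:
  fixes A :: "'a::semiring_1^'n^'n"
  assumes "invertible A"
  shows "A ** matrix_inv A = mat 1"
  using someI_ex[OF assms[unfolded invertible_def]] by (simp add: matrix_inv_def)

lemma matrix_inv_left:
  fixes A :: "'a::semiring_1^'n^'n"
  assumes "invertible A"
  shows "matrix_inv A ** A = mat 1"
  using someI_ex[OF assms[unfolded invertible_def]] by (simp add: matrix_inv_def)

lemma invertible_matrix_inv:
  fixes A :: "'a::semiring_1^'n^'n"
  assumes "invertible A"
  shows "invertible (matrix_inv A)"
  using matrix_inv_left[OF assms] matrix_inv_right[OF assms] unfolding invertible_def by blast

lemma borel_measurable_matrix_vector_mult [measurable]: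
  "(*v) (B::real^'n^'m) \<in> borel_measurable borel"
  by (intro borel_measurable_continuous_onI linear_continuous_on matrix_vector_mul_bounded_linear)

lemma lborel_eq_density_matrix_vector_mult:
  fixes B :: "real^('n::{finite,wellorder})^('n::{finite,wellorder})"
  assumes B: "invertible B"
  shows "lborel = density (distr lborel borel ((*v) B)) (\<lambda>_. ennreal \<bar>det B\<bar>)"
proof (rule lborel_eqI)
  fix l u :: "real^('n::{finite,wellorder})" assume le: "\<And>b. b \<in> Basis \<Longrightarrow> l \<bullet> b \<le> u \<bullet> b"
  define Bi where "Bi = matrix_inv B"
  have preimage: "(*v) B -` box l u = (*v) Bi ` box l u"
  proof (intro set_eqI iffI)
    fix x assume "x \<in> (*v) B -` box l u"
    moreover have "x = Bi *v (B *v x)"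
      using matrix_inv_left[OF B] by (simp add: Bi_def matrix_vector_mul_assoc)
    ultimately show "x \<in> (*v) Bi ` box l u" by blast
  qed (use matrix_inv_right[OF B] in \<open>auto simp: Bi_def matrix_vector_mul_assoc\<close>)
  have borel: "(*v) B -` box l u \<in> sets borel"
    by (intro borel_open open_vimage) (auto intro: linear_continuous_on)
  have "bounded ((*v) Bi ` box l u)"
    by (intro bounded_linear_image bounded_box matrix_vector_mul_bounded_linear)
  then have finite: "emeasure lborel ((*v) B -` box l u) < top"
    using emeasure_bounded_finite preimage by (auto simp: less_top)
  have det: "\<bar>det B\<bar> * \<bar>det Bi\<bar> = 1"
    using matrix_inv_right[OF B] by (simp add: Bi_def abs_mult[symmetric] det_mul[symmetric])
  have "emeasure (density (distr lborel borel ((*v) B)) (\<lambda>_. ennreal \<bar>det B\<bar>)) (box l u)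
      = ennreal \<bar>det B\<bar> * emeasure lborel ((*v) B -` box l u)"
    by (simp add: emeasure_density nn_integral_cmult_indicator emeasure_distr)
  also have "emeasure lborel ((*v) B -` box l u) = ennreal (measure lborel ((*v) B -` box l u))"
    using finite by (simp add: emeasure_eq_ennreal_measure less_top)
  also have "measure lborel ((*v) B -` box l u) = measure lebesgue ((*v) Bi ` box l u)"
    using borel preimage by simp
  also have "measure lebesgue ((*v) Bi ` box l u) = \<bar>det Bi\<bar> * (\<Prod>b\<in>Basis. (u - l) \<bullet> b)"
    using le by (simp add: measure_lebesgue_linear_transformation measure_lborel_box_eq)
  finally show "emeasure (density (distr lborel borel ((*v) B)) (\<lambda>_. ennreal \<bar>det B\<bar>)) (box l u)
      = (\<Prod>b\<in>Basis. (u - l) \<bullet> b)"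
    using det le by (simp add: ennreal_mult'[symmetric] mult.assoc[symmetric] prod_nonneg)
qed simp

lemma nn_integral_matrix_vector_mult:
  fixes B :: "real^('n::{finite,wellorder})^('n::{finite,wellorder})"
    and f :: "real^('n::{finite,wellorder}) \<Rightarrow> ennreal"
  assumes B: "invertible B" and [measurable]: "f \<in> borel_measurable borel"
  shows "(\<integral>\<^sup>+x. f (B *v x) \<partial>lborel) = ennreal (1 / \<bar>det B\<bar>) * (\<integral>\<^sup>+x. f x \<partial>lborel)"
proof -
  have "(\<integral>\<^sup>+x. f x \<partial>lborel) = ennreal \<bar>det B\<bar> * (\<integral>\<^sup>+x. f (B *v x) \<partial>lborel)"
    by (subst lborel_eq_density_matrix_vector_mult[OF B])
       (simp add: nn_integral_density nn_integral_distr nn_integral_cmult)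
  moreover have "ennreal (1 / \<bar>det B\<bar>) * ennreal \<bar>det B\<bar> = 1"
    using B by (simp add: invertible_det_nz ennreal_mult'[symmetric])
  ultimately show ?thesis by (simp add: mult.assoc[symmetric])
qed

lemma nn_integral_lborel_translate:
  fixes f :: "'a::euclidean_space \<Rightarrow> ennreal"
  assumes [measurable]: "f \<in> borel_measurable borel"
  shows "(\<integral>\<^sup>+x. f (c + x) \<partial>lborel) = (\<integral>\<^sup>+x. f x \<partial>lborel)"
  by (subst (2) lborel_distr_plus[of c, symmetric]) (simp add: nn_integral_distr)

lemma nn_integral_lborel_reflect:
  fixes f :: "'a::euclidean_space \<Rightarrow> ennreal"
  assumes [measurable]: "f \<in> borel_measurable borel"
  shows "(\<integral>\<^sup>+y. f (c - y) \<partial>lborel) = (\<integral>\<^sup>+x. f x \<partial>lborel)"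
proof -
  have "lborel = density (distr lborel borel ((-) c)) (\<lambda>_. 1)"
    using lborel_affine[of "-1" c] by simp
  moreover have "(\<integral>\<^sup>+x. f x \<partial>density (distr lborel borel ((-) c)) (\<lambda>_. 1)) = (\<integral>\<^sup>+y. f (c - y) \<partial>lborel)"
    by (simp add: nn_integral_density nn_integral_distr)
  ultimately show ?thesis by simp
qed

lemma nn_integral_convolution:
  fixes f g :: "'a::euclidean_space \<Rightarrow> ennreal"
  assumes [measurable]: "f \<in> borel_measurable borel" "g \<in> borel_measurable borel"
  shows "(\<integral>\<^sup>+x. \<integral>\<^sup>+y. f (x - y) * g y \<partial>lborel \<partial>lborel)
    = (\<integral>\<^sup>+x. f x \<partial>lborel) * (\<integral>\<^sup>+y. g y \<partial>lborel)"
proof -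
  have shift: "(\<integral>\<^sup>+x. f (x - y) \<partial>lborel) = (\<integral>\<^sup>+x. f x \<partial>lborel)" for y
    using nn_integral_lborel_translate[of f "- y"] by simp
  have "(\<lambda>(x, y). f (x - y) * g y) \<in> borel_measurable (lborel \<Otimes>\<^sub>M lborel)"
    by measurable
  then have "(\<integral>\<^sup>+x. \<integral>\<^sup>+y. f (x - y) * g y \<partial>lborel \<partial>lborel)
      = (\<integral>\<^sup>+y. \<integral>\<^sup>+x. f (x - y) * g y \<partial>lborel \<partial>lborel)"
    by (rule lborel_pair.Fubini'[symmetric, simplified])
  also have "\<dots> = (\<integral>\<^sup>+y. (\<integral>\<^sup>+x. f x \<partial>lborel) * g y \<partial>lborel)"
    by (simp add: nn_integral_multc shift)
  finally show ?thesis by (simp add: nn_integral_cmult)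
qed

lemma nn_integral_inverse_square_le:
  "(\<integral>\<^sup>+t. ennreal (1 / (1 + \<bar>t::real\<bar>)^2) \<partial>lborel) \<le> 2"
proof -
  define g where "g t = ennreal (1 / (1 + t)^2) * indicator {0::real..} t" for t
  have [measurable]: "g \<in> borel_measurable borel" unfolding g_def by measurable
  have half: "(\<integral>\<^sup>+t. g t \<partial>lborel) = 1"
  proof -
    have "(\<integral>\<^sup>+t\<in>{0::real..}. ennreal (1 / (1 + t)^2) \<partial>lborel) = ennreal (0 - (- inverse (1 + 0)))"
    proof (rule nn_integral_FTC_atLeast)
      fix x :: real assume "0 \<le> x"
      then show "((\<lambda>t. - inverse (1 + t)) has_real_derivative 1 / (1 + x)^2) (at x)"
        by (auto intro!: derivative_eq_intros simp: power2_eq_square field_simps)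
    next
      have "filterlim (\<lambda>t::real. 1 + t) at_top at_top"
        by (rule filterlim_tendsto_add_at_top[OF tendsto_const filterlim_ident])
      then show "((\<lambda>t::real. - inverse (1 + t)) \<longlongrightarrow> 0) at_top"
        using tendsto_minus[OF tendsto_inverse_0_at_top] by fastforce
    qed simp_all
    then show ?thesis by (simp add: g_def)
  qed
  have "ennreal (1 / (1 + \<bar>t\<bar>)^2) \<le> g t + g (0 + (-1) * t)" for t :: real
  proof (cases "0 \<le> t")
    case True
    then have "ennreal (1 / (1 + \<bar>t\<bar>)^2) = g t" by (simp add: g_def)
    then show ?thesis by (simp add: add_increasing2)
  next
    case False
    then have "ennreal (1 / (1 + \<bar>t\<bar>)^2) = g (0 + (-1) * t)" by (simp add: g_def)
    then show ?thesis by (simp add: add_increasing)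
  qed
  then have "(\<integral>\<^sup>+t. ennreal (1 / (1 + \<bar>t::real\<bar>)^2) \<partial>lborel) \<le> (\<integral>\<^sup>+t. g t + g (0 + (-1) * t) \<partial>lborel)"
    by (intro nn_integral_mono)
  also have "\<dots> = (\<integral>\<^sup>+t. g t \<partial>lborel) + (\<integral>\<^sup>+t. g (0 + (-1) * t) \<partial>lborel)"
    by (rule nn_integral_add) auto
  also have "(\<integral>\<^sup>+t. g (0 + (-1) * t) \<partial>lborel) = (\<integral>\<^sup>+t. g t \<partial>lborel)"
    using nn_integral_real_affine[of g "-1" 0] by simp
  finally show ?thesis by (simp add: half)
qed

text \<open>Dominate the radial weight by a product of one-dimensional integrable weights.\<close>
lemma nn_integral_powr_decay_finite:
  fixes E :: real
  assumes E: "2 * DIM('a) \<le> E"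
  shows "(\<integral>\<^sup>+(z::'a::euclidean_space). ennreal ((1 + norm z) powr - E) \<partial>lborel) < top"
proof -
  have pointwise: "(1 + norm z) powr - E \<le> (\<Prod>b\<in>Basis. 1 / (1 + \<bar>z \<bullet> b\<bar>)^2)" for z :: 'a
  proof -
    have pos: "0 < 1 + norm z"
      by (simp add: add_pos_nonneg)
    have "(1 + norm z) powr - E \<le> (1 + norm z) powr - real (2 * DIM('a))"
      using E by (intro powr_mono) auto
    also have "\<dots> = inverse ((1 + norm z) ^ (2 * DIM('a)))"
      using powr_realpow[OF pos, of "2 * DIM('a)"] by (simp add: powr_minus)
    also have "\<dots> = (\<Prod>b\<in>(Basis::'a set). 1 / (1 + norm z)^2)"
      by (simp add: power_mult power_one_over divide_inverse power_inverse)
    also have "\<dots> \<le> (\<Prod>b\<in>Basis. 1 / (1 + \<bar>z \<bullet> b\<bar>)^2)"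
      by (intro prod_mono) (use pos in \<open>auto intro!: divide_left_mono power_mono mult_pos_pos Basis_le_norm\<close>)
    finally show ?thesis .
  qed
  have "(\<integral>\<^sup>+(z::'a). ennreal ((1 + norm z) powr - E) \<partial>lborel)
      \<le> (\<integral>\<^sup>+(z::'a). ennreal (\<Prod>b\<in>Basis. 1 / (1 + \<bar>z \<bullet> b\<bar>)^2) \<partial>lborel)"
    by (intro nn_integral_mono ennreal_leI pointwise)
  also have "\<dots> = (\<integral>\<^sup>+t. ennreal (1 / (1 + \<bar>t\<bar>)^2) \<partial>lborel) ^ DIM('a)"
    using nn_integral_lborel_prod[where 'a='a, of "\<lambda>b t. 1 / (1 + \<bar>t\<bar>)^2"]
    by (simp add: prod_ennreal)
  also have "\<dots> \<le> 2 ^ DIM('a)"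
    by (rule power_mono[OF nn_integral_inverse_square_le]) simp
  also have "\<dots> < top" by (simp add: power_less_top_ennreal)
  finally show ?thesis .
qed

section \<open>The weights and their convolutions\<close>

definition weight_mass :: "real \<Rightarrow> ennreal" where
  "weight_mass E = (\<integral>\<^sup>+(z::real^3). ennreal ((1 + norm z) powr - E) \<partial>lborel)"

lemma weight_mass_finite: "6 \<le> E \<Longrightarrow> weight_mass E < top"
  unfolding weight_mass_def by (rule nn_integral_powr_decay_finite) simp

lemma phiT_nonneg: "0 \<le> phiT A c E y"
  by (simp add: phiT_def wT_def)

lemma borel_measurable_phiT [measurable]: "phiT A c E \<in> borel_measurable borel"
  unfolding phiT_def wT_def by measurable

lemma nn_integral_phiT:
  fixes A :: "real^3^3"
  assumes A: "invertible A"
  shows "(\<integral>\<^sup>+y. ennreal (phiT A c E y) \<partial>lborel) = weight_mass E"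
proof -
  define Ai where "Ai = matrix_inv A"
  define w where "w z = ennreal ((1 + norm z) powr - E)" for z :: "real^3"
  have [measurable]: "w \<in> borel_measurable borel"
    unfolding w_def by measurable
  have Ai: "invertible Ai"
    unfolding Ai_def by (rule invertible_matrix_inv[OF A])
  have "det A * det Ai = 1"
    using matrix_inv_right[OF A] by (simp add: Ai_def det_mul[symmetric])
  then have det: "ennreal (1 / \<bar>det A\<bar>) * ennreal (1 / \<bar>det Ai\<bar>) = 1"
    by (simp add: ennreal_mult'[symmetric] abs_mult[symmetric])
  have "(\<integral>\<^sup>+y. ennreal (phiT A c E y) \<partial>lborel) = (\<integral>\<^sup>+y. ennreal (1 / \<bar>det A\<bar>) * w (Ai *v (y - c)) \<partial>lborel)"
    by (intro nn_integral_cong)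
       (simp add: phiT_def wT_def w_def Ai_def ennreal_mult'[symmetric] divide_inverse mult.commute)
  also have "\<dots> = ennreal (1 / \<bar>det A\<bar>) * (\<integral>\<^sup>+y. w (Ai *v y) \<partial>lborel)"
    using nn_integral_lborel_translate[of "\<lambda>y. w (Ai *v y)" "- c"] by (simp add: nn_integral_cmult)
  also have "(\<integral>\<^sup>+y. w (Ai *v y) \<partial>lborel) = ennreal (1 / \<bar>det Ai\<bar>) * (\<integral>\<^sup>+z. w z \<partial>lborel)"
    by (rule nn_integral_matrix_vector_mult[OF Ai]) measurable
  finally show ?thesis
    by (simp add: mult.assoc[symmetric] det weight_mass_def w_def)
qed

lemma det_MT: "det (MT I) = 12 * (Sup I - Inf I)^6"
  by (simp add: MT_def Let_def det_3; algebra)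

lemma invertible_TA: "Inf I < Sup I \<Longrightarrow> invertible (TA I)"
  unfolding TA_def
  by (intro scalar_invertible invertible_matrix_inv) (auto simp: invertible_det_nz det_MT)

lemma convI_eq:
  "convI F p I E x
    = (\<integral>\<^sup>+y. ennreal (cmod (F (x - y)) ^ p) * ennreal (phiT (TA I) (Tc I) E y) \<partial>lborel)"
  by (simp add: convI_def ennreal_mult' phiT_nonneg mult.commute)

lemma borel_measurable_convI [measurable]:
  assumes [measurable]: "F \<in> borel_measurable borel"
  shows "convI F p I E \<in> borel_measurable borel"
proof -
  have "(\<lambda>(x, y). ennreal (cmod (F (x - y)) ^ p) * ennreal (phiT (TA I) (Tc I) E y))
      \<in> borel_measurable (lborel \<Otimes>\<^sub>M lborel)"
    by measurable
  from lborel.borel_measurable_nn_integral[OF this] show ?thesis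
    by (simp add: convI_eq[abs_def])
qed

lemma nn_integral_convI:
  assumes [measurable]: "F \<in> borel_measurable borel" and I: "invertible (TA I)"
  shows "(\<integral>\<^sup>+x. convI F p I E x \<partial>lborel) = (\<integral>\<^sup>+x. ennreal (cmod (F x) ^ p) \<partial>lborel) * weight_mass E"
  using nn_integral_convolution[of "\<lambda>z. ennreal (cmod (F z) ^ p)" "\<lambda>y. ennreal (phiT (TA I) (Tc I) E y)"]
  by (simp add: convI_eq nn_integral_phiT[OF I])

lemma convI_0: "invertible (TA I) \<Longrightarrow> convI F 0 I E x = weight_mass E"
  by (simp add: convI_eq nn_integral_phiT)

lemma convI_eq_0:
  assumes [measurable]: "F \<in> borel_measurable borel"
    and zero: "(\<integral>\<^sup>+x. ennreal (cmod (F x) ^ p) \<partial>lborel) = 0"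
  shows "convI F p I E x = 0"
proof -
  have "(\<integral>\<^sup>+y. ennreal (cmod (F (x - y)) ^ p) \<partial>lborel) = 0"
    using zero nn_integral_lborel_reflect[of "\<lambda>z. ennreal (cmod (F z) ^ p)" x] by simp
  then have "AE y in lborel. ennreal (cmod (F (x - y)) ^ p) = 0"
    by (simp add: nn_integral_0_iff_AE)
  then have "AE y in lborel. ennreal (cmod (F (x - y)) ^ p) * ennreal (phiT (TA I) (Tc I) E y) = 0"
    by eventually_elim simp
  then show ?thesis
    by (simp add: convI_eq nn_integral_0_iff_AE)
qed

lemma power_mult_interpolate:
  fixes c w \<theta> :: real
  assumes "0 \<le> c" "0 \<le> w" "0 < \<theta>" "\<theta> < 1" and p: "real p = \<theta> * real q + (1 - \<theta>) * real r"
  shows "c ^ p * w = (c ^ q * w) powr \<theta> * (c ^ r * w) powr (1 - \<theta>)"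
proof (cases "c = 0 \<or> w = 0")
  case True
  have "real p = 0 \<longleftrightarrow> \<theta> * real q = 0 \<and> (1 - \<theta>) * real r = 0"
    using p assms(3,4) by (simp add: add_nonneg_eq_0_iff)
  then have "p = 0 \<longleftrightarrow> q = 0 \<and> r = 0"
    using assms(3,4) by simp
  with True show ?thesis
    using assms by (cases "p = 0") (auto simp: powr_add[symmetric] zero_power)
next
  case False
  then have c: "0 < c" and w: "0 < w" using assms by auto
  have "(c ^ q * w) powr \<theta> * (c ^ r * w) powr (1 - \<theta>)
      = c powr (\<theta> * real q + (1 - \<theta>) * real r) * (w powr \<theta> * w powr (1 - \<theta>))"
    using c w by (simp add: powr_mult powr_realpow[symmetric] powr_powr powr_add mult.commute mult.left_commute)
  also have "\<dots> = c ^ p * w"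
    using c w by (simp add: p[symmetric] powr_add[symmetric] powr_realpow)
  finally show ?thesis ..
qed

text \<open>Pointwise Holder: the convolution \<open>\<bar>F\<bar>\<^sup>p * \<phi>\<close> is log-convex in \<open>p\<close>.\<close>
lemma convI_interpolate:
  assumes [measurable]: "F \<in> borel_measurable borel"
    and \<theta>: "0 < \<theta>" "\<theta> < 1" and p: "real p = \<theta> * real q + (1 - \<theta>) * real r"
  shows "convI F p I E x \<le> enn_powr \<theta> (convI F q I E x) * enn_powr (1 - \<theta>) (convI F r I E x)"
proof -
  have "convI F p I E x = (\<integral>\<^sup>+y. enn_powr \<theta> (ennreal (cmod (F (x - y)) ^ q * phiT (TA I) (Tc I) E y))
      * enn_powr (1 - \<theta>) (ennreal (cmod (F (x - y)) ^ r * phiT (TA I) (Tc I) E y)) \<partial>lborel)"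
    unfolding convI_def using \<theta>
    by (intro nn_integral_cong)
       (simp add: phiT_nonneg ennreal_mult'[symmetric] power_mult_interpolate[OF _ _ \<theta> p])
  also have "\<dots> \<le> enn_powr \<theta> (convI F q I E x) * enn_powr (1 - \<theta>) (convI F r I E x)"
    unfolding convI_def using \<theta> by (intro nn_integral_Holder) simp_all
  finally show ?thesis .
qed

lemma nn_integral_convI_2_10_Holder:
  assumes [measurable]: "FA \<in> borel_measurable borel" "FB \<in> borel_measurable borel"
    and I: "invertible (TA I)" and I': "invertible (TA I')"
  shows "(\<integral>\<^sup>+x. convI FA 2 I E x * convI FB 10 I' E x \<partial>lborel)
    \<le> enn_powr (3/4) (weight_mass E)
      * (enn_powr (1/4) (\<integral>\<^sup>+x. convI FB 4 I' E x * convI FA 8 I E x \<partial>lborel)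
       * enn_powr (3/4) ((\<integral>\<^sup>+x. ennreal (cmod (FB x) ^ 12) \<partial>lborel) * weight_mass E))"
proof -
  have pointwise: "convI FA 2 I E x * convI FB 10 I' E x
      \<le> enn_powr (3/4) (weight_mass E)
        * (enn_powr (1/4) (convI FB 4 I' E x * convI FA 8 I E x) * enn_powr (3/4) (convI FB 12 I' E x))"
    for x
  proof -
    have "convI FA 2 I E x \<le> enn_powr (1/4) (convI FA 8 I E x) * enn_powr (3/4) (convI FA 0 I E x)"
      using convI_interpolate[of FA "1/4" 2 8 0] by simp
    moreover have "convI FB 10 I' E x \<le> enn_powr (1/4) (convI FB 4 I' E x) * enn_powr (3/4) (convI FB 12 I' E x)"
      using convI_interpolate[of FB "1/4" 10 4 12] by simp
    ultimately have "convI FA 2 I E x * convI FB 10 I' E x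
        \<le> (enn_powr (1/4) (convI FA 8 I E x) * enn_powr (3/4) (convI FA 0 I E x))
          * (enn_powr (1/4) (convI FB 4 I' E x) * enn_powr (3/4) (convI FB 12 I' E x))"
      by (rule mult_mono) simp_all
    then show ?thesis
      by (simp add: convI_0[OF I] enn_powr_mult ac_simps)
  qed
  have Holder: "(\<integral>\<^sup>+x. enn_powr (1/4) (convI FB 4 I' E x * convI FA 8 I E x)
        * enn_powr (3/4) (convI FB 12 I' E x) \<partial>lborel)
      \<le> enn_powr (1/4) (\<integral>\<^sup>+x. convI FB 4 I' E x * convI FA 8 I E x \<partial>lborel)
        * enn_powr (3/4) ((\<integral>\<^sup>+x. ennreal (cmod (FB x) ^ 12) \<partial>lborel) * weight_mass E)"
    using nn_integral_Holder[of "1/4" "\<lambda>x. convI FB 4 I' E x * convI FA 8 I E x" lborel "convI FB 12 I' E"]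
    by (simp add: nn_integral_convI[OF _ I'])
  have "(\<integral>\<^sup>+x. convI FA 2 I E x * convI FB 10 I' E x \<partial>lborel)
      \<le> (\<integral>\<^sup>+x. enn_powr (3/4) (weight_mass E) * (enn_powr (1/4) (convI FB 4 I' E x * convI FA 8 I E x)
          * enn_powr (3/4) (convI FB 12 I' E x)) \<partial>lborel)"
    by (intro nn_integral_mono pointwise)
  also have "\<dots> = enn_powr (3/4) (weight_mass E) * (\<integral>\<^sup>+x. enn_powr (1/4) (convI FB 4 I' E x * convI FA 8 I E x)
        * enn_powr (3/4) (convI FB 12 I' E x) \<partial>lborel)"
    by (rule nn_integral_cmult) simp
  also have "\<dots> \<le> enn_powr (3/4) (weight_mass E)
      * (enn_powr (1/4) (\<integral>\<^sup>+x. convI FB 4 I' E x * convI FA 8 I E x \<partial>lborel)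
       * enn_powr (3/4) ((\<integral>\<^sup>+x. ennreal (cmod (FB x) ^ 12) \<partial>lborel) * weight_mass E))"
    by (rule mult_left_mono[OF Holder]) simp
  finally show ?thesis .
qed

lemma nn_integral_convI_2_10_le:
  assumes [measurable]: "FA \<in> borel_measurable borel" "FB \<in> borel_measurable borel"
    and I: "invertible (TA I)" and I': "invertible (TA I')"
    and K: "weight_mass E = ennreal K" "0 \<le> K"
    and bilinear: "(\<integral>\<^sup>+x. convI FB 4 I' E x * convI FA 8 I E x \<partial>lborel) \<le> m ^ 12 * S' * S ^ 2"
    and decoupling: "(\<integral>\<^sup>+x. ennreal (cmod (FB x) ^ 12) \<partial>lborel) \<le> d ^ 12 * enn_powr 3 S'"
  shows "(\<integral>\<^sup>+x. convI FA 2 I E x * convI FB 10 I' E x \<partial>lborel)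
    \<le> (ennreal (K powr (1/8)) * enn_powr (1/4) m * enn_powr (3/4) d) ^ 12
      * enn_powr (1/2) S * enn_powr (5/2) S'"
proof -
  let ?k = "enn_powr (3/4) (ennreal K)"
  have "enn_powr (1/4) (\<integral>\<^sup>+x. convI FB 4 I' E x * convI FA 8 I E x \<partial>lborel)
        * enn_powr (3/4) ((\<integral>\<^sup>+x. ennreal (cmod (FB x) ^ 12) \<partial>lborel) * ennreal K)
      \<le> enn_powr (1/4) (m ^ 12 * S' * S ^ 2) * enn_powr (3/4) (d ^ 12 * enn_powr 3 S' * ennreal K)"
    by (intro mult_mono enn_powr_mono mult_right_mono bilinear decoupling) simp_all
  from order.trans[OF nn_integral_convI_2_10_Holder[OF assms(1-4), of E, unfolded K(1)]
      mult_left_mono[OF this zero_le]]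
  have "(\<integral>\<^sup>+x. convI FA 2 I E x * convI FB 10 I' E x \<partial>lborel)
      \<le> ?k * (enn_powr (1/4) (m ^ 12 * S' * S ^ 2) * enn_powr (3/4) (d ^ 12 * enn_powr 3 S' * ennreal K))" .
  also have "\<dots> = (ennreal (K powr (1/8)) * enn_powr (1/4) m * enn_powr (3/4) d) ^ 12
      * enn_powr (1/2) S * enn_powr (5/2) S'"
  proof -
    have "enn_powr (1/4) (m ^ 12 * S' * S ^ 2) = enn_powr 3 m * enn_powr (1/4) S' * enn_powr (1/2) S"
      by (simp add: enn_powr_mult enn_powr_of_power)
    moreover have "enn_powr (3/4) (d ^ 12 * enn_powr 3 S' * ennreal K) = enn_powr 9 d * enn_powr (9/4) S' * ?k"
      by (simp add: enn_powr_mult enn_powr_of_power enn_powr_enn_powr del: enn_powr_ennreal)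
    moreover have "ennreal (K powr (1/8)) ^ 12 = ?k * ?k"
    proof -
      have "ennreal (K powr (1/8)) ^ 12 = enn_powr (1/8) (ennreal K) ^ 12"
        using K(2) by simp
      also have "\<dots> = ?k * ?k"
        by (simp add: enn_powr_power enn_powr_add del: enn_powr_ennreal)
      finally show ?thesis .
    qed
    moreover have "enn_powr (1/4) S' * enn_powr (9/4) S' = enn_powr (5/2) S'"
      by (simp add: enn_powr_add)
    ultimately show ?thesis
      by (simp add: power_mult_distrib enn_powr_power ac_simps)
  qed
  finally show ?thesis .
qed

section \<open>The extension operator\<close>

lemma norm_e [simp]: "cmod (e t) = 1"
proof -
  have "e t = exp (\<i> * complex_of_real (2 * pi * t))"
    by (simp add: e_def ac_simps)
  then show ?thesis by (simp only: norm_exp_i_times)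
qed

lemma e_add: "e (a + b) = e a * e b"
  by (simp add: e_def distrib_left exp_add)

lemma borel_measurable_e [measurable]: "e \<in> borel_measurable borel"
  unfolding e_def by (intro borel_measurable_continuous_onI continuous_intros)

lemma inner_gam: "x \<bullet> gam \<xi> = x$1 * \<xi> + x$2 * \<xi>^2 + x$3 * \<xi>^3"
  by (simp add: gam_def inner_vec_def sum_3)

lemma L12_power_12: "L12 F ^ 12 = (\<integral>\<^sup>+x. ennreal (cmod (F x) ^ 12) \<partial>lborel)"
  by (simp add: L12_def enn_powr_power)

lemma L12_eq_0_iff_AE:
  assumes [measurable]: "F \<in> borel_measurable borel"
  shows "L12 F = 0 \<longleftrightarrow> (AE x in lborel. F x = 0)"
  by (simp add: L12_def nn_integral_0_iff_AE)

lemma borel_measurable_g_ok: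
  "g_ok g \<Longrightarrow> (\<lambda>\<xi>. indicator {0..1::real} \<xi> *\<^sub>R g \<xi>) \<in> borel_measurable borel"
  unfolding g_ok_def set_integrable_def by (drule borel_measurable_integrable) simp

lemma ext_eq_indicator_g:
  assumes "J \<subseteq> {0..1}"
  shows "ext J g x = (\<integral>\<xi>. indicator J \<xi> *\<^sub>R ((indicator {0..1} \<xi> *\<^sub>R g \<xi>) * e (x \<bullet> gam \<xi>)) \<partial>lborel)"
  unfolding ext_def set_lebesgue_integral_def
  using assms by (intro Bochner_Integration.integral_cong) (auto simp: indicator_def)

lemma borel_measurable_inner_gam [measurable]:
  "(\<lambda>p::(real^3) \<times> real. fst p \<bullet> gam (snd p)) \<in> borel_measurable (borel \<Otimes>\<^sub>M borel)"
  unfolding borel_prod inner_gam by (intro borel_measurable_continuous_onI continuous_intros)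

lemma borel_measurable_ext:
  assumes g: "g_ok g" and J: "J \<subseteq> {0..1}" "J \<in> sets borel"
  shows "ext J g \<in> borel_measurable borel"
proof -
  define G where "G \<xi> = indicator {0..1::real} \<xi> *\<^sub>R g \<xi>" for \<xi>
  have [measurable]: "G \<in> borel_measurable borel" "J \<in> sets borel"
    using borel_measurable_g_ok[OF g] J(2) by (simp_all add: G_def[abs_def])
  have "(\<lambda>p::(real^3) \<times> real. indicator J (snd p) *\<^sub>R (G (snd p) * e (fst p \<bullet> gam (snd p))))
      \<in> borel_measurable (borel \<Otimes>\<^sub>M borel)"
    by measurable
  then have "(\<lambda>(x, \<xi>). indicator J \<xi> *\<^sub>R (G \<xi> * e (x \<bullet> gam \<xi>))) \<in> borel_measurable (borel \<Otimes>\<^sub>M lborel)"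
    by (simp add: case_prod_beta' cong: measurable_cong_sets)
  moreover have "ext J g = (\<lambda>x. \<integral>\<xi>. indicator J \<xi> *\<^sub>R (G \<xi> * e (x \<bullet> gam \<xi>)) \<partial>lborel)"
    unfolding G_def by (rule ext) (rule ext_eq_indicator_g[OF J(1)])
  ultimately show ?thesis
    using lborel.borel_measurable_lebesgue_integral by simp
qed

lemma set_integrable_ext_integrand:
  assumes g: "g_ok g" and J: "J \<subseteq> {0..1}" "J \<in> sets borel"
  shows "set_integrable lborel J (\<lambda>\<xi>. g \<xi> * e (x \<bullet> gam \<xi>))"
proof (rule set_integrable_bound)
  show "set_integrable lborel J g"
    using g unfolding g_ok_def by (rule set_integrable_subset[OF _ _ J(1)]) (use J(2) in simp)
  define G where "G \<xi> = indicator {0..1::real} \<xi> *\<^sub>R g \<xi>" for \<xi>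
  have "(\<lambda>\<xi>. x \<bullet> gam \<xi>) \<in> borel_measurable borel"
    unfolding inner_gam by (intro borel_measurable_continuous_onI continuous_intros)
  then have "(\<lambda>\<xi>. indicator J \<xi> *\<^sub>R (G \<xi> * e (x \<bullet> gam \<xi>))) \<in> borel_measurable borel"
    using borel_measurable_g_ok[OF g] J(2)
    by (intro borel_measurable_scaleR borel_measurable_indicator borel_measurable_times
        measurable_compose[OF _ borel_measurable_e]) (simp_all add: G_def[abs_def])
  also have "(\<lambda>\<xi>. indicator J \<xi> *\<^sub>R (G \<xi> * e (x \<bullet> gam \<xi>)))
      = (\<lambda>\<xi>. indicator J \<xi> *\<^sub>R (g \<xi> * e (x \<bullet> gam \<xi>)))"
    using J(1) by (intro ext) (auto simp: G_def indicator_def)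
  finally show "set_borel_measurable lborel J (\<lambda>\<xi>. g \<xi> * e (x \<bullet> gam \<xi>))"
    by (simp add: set_borel_measurable_def)
  show "AE \<xi> in lborel. \<xi> \<in> J \<longrightarrow> norm (g \<xi> * e (x \<bullet> gam \<xi>)) \<le> norm (g \<xi>)"
    by (simp add: norm_mult)
qed

lemma sum_part:
  assumes "\<sigma> > 0"
  shows "sum F (part \<sigma> l r) = (\<Sum>k<nat \<lfloor>(r - l) / \<sigma>\<rfloor>. F {l + real k * \<sigma> .. l + (real k + 1) * \<sigma>})"
proof -
  have "part \<sigma> l r = (\<lambda>k. {l + real k * \<sigma> .. l + (real k + 1) * \<sigma>}) ` {..<nat \<lfloor>(r - l) / \<sigma>\<rfloor>}"
    unfolding part_def by blast
  moreover have "inj (\<lambda>k. {l + real k * \<sigma> .. l + (real k + 1) * \<sigma>})"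
    using assms by (intro injI) (auto simp: algebra_simps)
  ultimately show ?thesis
    by (simp add: sum.reindex inj_on_subset[of _ UNIV])
qed

lemma mem_part_unit_intervalE:
  assumes s: "s > 0" and I: "I \<in> part s 0 1"
  obtains l where "I = {l..l + s}" "0 \<le> l" "l + s \<le> 1"
proof -
  obtain k where k: "k < nat \<lfloor>1 / s\<rfloor>" and I: "I = {real k * s .. (real k + 1) * s}"
    using I unfolding part_def by auto
  then have "int (k + 1) \<le> \<lfloor>1 / s\<rfloor>"
    by (simp add: zless_nat_eq_int_zless)
  then have "real (k + 1) \<le> 1 / s"
    by (simp add: le_floor_iff)
  then have "(real k + 1) * s \<le> 1"
    using s by (simp add: field_simps)
  with I s show thesis
    by (intro that[of "real k * s"]) (auto simp: algebra_simps)
qed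

lemma sum_part_Icc:
  assumes "s > 0" "\<delta> > 0" "s / \<delta> = real n"
  shows "(\<Sum>J\<in>part \<delta> (Inf {l..l+s}) (Sup {l..l+s}). F J) = (\<Sum>k<n. F {l + real k * \<delta> .. l + (real k + 1) * \<delta>})"
  using assms by (simp add: sum_part)

lemma ext_Icc_eq_sum:
  assumes g: "g_ok g" and l: "0 \<le> l" and \<delta>: "\<delta> > 0" and n: "l + real n * \<delta> \<le> 1"
  shows "ext {l..l + real n * \<delta>} g x = (\<Sum>k<n. ext {l + real k * \<delta> .. l + (real k + 1) * \<delta>} g x)"
  using n
proof (induction n)
  case 0
  have "AE \<xi> in lborel. indicator {l..l} \<xi> *\<^sub>R (g \<xi> * e (x \<bullet> gam \<xi>)) = 0"
    using AE_lborel_singleton[of l] by eventually_elim simp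
  then show ?case
    by (simp add: ext_def set_lebesgue_integral_def integral_eq_zero_AE)
next
  case (Suc n)
  define A B where "A = {l..l + real n * \<delta>}" and "B = {l + real n * \<delta> .. l + (real n + 1) * \<delta>}"
  have le: "l \<le> l + real n * \<delta>" "l + real n * \<delta> \<le> l + (real n + 1) * \<delta>"
    "l + (real n + 1) * \<delta> \<le> 1"
    using \<delta> Suc.prems by (simp_all add: algebra_simps)
  then have AB: "{l..l + real (Suc n) * \<delta>} = A \<union> B"
    unfolding A_def B_def by (simp add: ivl_disj_un_two_touch(4))
  from le have "A \<subseteq> {0..1}" "B \<subseteq> {0..1}"
    using l by (auto simp: A_def B_def)
  then have "set_integrable lborel A (\<lambda>\<xi>. g \<xi> * e (x \<bullet> gam \<xi>))"
    "set_integrable lborel B (\<lambda>\<xi>. g \<xi> * e (x \<bullet> gam \<xi>))"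
    by (auto simp: A_def B_def intro!: set_integrable_ext_integrand[OF g])
  moreover have "AE \<xi> in lborel. \<not> (\<xi> \<in> A \<and> \<xi> \<in> B)"
    using AE_lborel_singleton[of "l + real n * \<delta>"] by eventually_elim (auto simp: A_def B_def)
  ultimately have "ext {l..l + real (Suc n) * \<delta>} g x = ext A g x + ext B g x"
    unfolding ext_def AB by (intro set_integral_Un_AE) (simp_all add: A_def B_def)
  moreover have "ext A g x = (\<Sum>k<n. ext {l + real k * \<delta> .. l + (real k + 1) * \<delta>} g x)"
    unfolding A_def using le l by (intro Suc.IH) simp
  ultimately show ?case by (simp add: B_def)
qed

lemma AE_ext_eq_0:
  assumes g: "g_ok g" and l: "0 \<le> l" and \<delta>: "\<delta> > 0" and n: "l + real n * \<delta> \<le> 1"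
    and zero: "(\<Sum>k<n. L12 (ext {l + real k * \<delta> .. l + (real k + 1) * \<delta>} g) ^ 4) = 0"
  shows "AE x in lborel. ext {l..l + real n * \<delta>} g x = 0"
proof -
  have "AE x in lborel. ext {l + real k * \<delta> .. l + (real k + 1) * \<delta>} g x = 0" if k: "k < n" for k
  proof -
    have "(real k + 1) * \<delta> \<le> real n * \<delta>"
      using k \<delta> by (intro mult_right_mono) auto
    moreover have "0 \<le> real k * \<delta>"
      using \<delta> by simp
    ultimately have "{l + real k * \<delta> .. l + (real k + 1) * \<delta>} \<subseteq> {0..1}"
      using l n by auto
    moreover have "L12 (ext {l + real k * \<delta> .. l + (real k + 1) * \<delta>} g) = 0"
      using zero k by simp
    ultimately show ?thesis
      using borel_measurable_ext[OF g] by (simp add: L12_eq_0_iff_AE)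
  qed
  then have "AE x in lborel. \<forall>k<n. ext {l + real k * \<delta> .. l + (real k + 1) * \<delta>} g x = 0"
    by (simp add: AE_all_countable)
  then show ?thesis
    by eventually_elim (simp add: ext_Icc_eq_sum[OF g l \<delta> n])
qed

definition rescale_mat :: "real \<Rightarrow> real \<Rightarrow> real^3^3" where
  "rescale_mat l s = vector [vector [s, 2 * l * s, 3 * l^2 * s], vector [0, s^2, 3 * l * s^2], vector [0, 0, s^3]]"

lemma inner_gam_affine: "x \<bullet> gam (l + s * \<eta>) = x \<bullet> gam l + (rescale_mat l s *v x) \<bullet> gam \<eta>"
  by (simp add: inner_gam rescale_mat_def matrix_vector_mult_def sum_3; algebra)

lemma det_rescale_mat: "det (rescale_mat l s) = s^6"
  by (simp add: rescale_mat_def det_3; algebra)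

lemma ext_affine:
  assumes s: "s > 0"
  shows "ext {l + s * a .. l + s * b} g x
    = complex_of_real s * e (x \<bullet> gam l) * ext {a..b} (\<lambda>\<eta>. g (l + s * \<eta>)) (rescale_mat l s *v x)"
proof -
  define f where "f \<xi> = indicator {l + s * a .. l + s * b} \<xi> *\<^sub>R (g \<xi> * e (x \<bullet> gam \<xi>))" for \<xi>
  have f: "f (l + s * \<eta>)
      = e (x \<bullet> gam l) * (indicator {a..b} \<eta> *\<^sub>R (g (l + s * \<eta>) * e ((rescale_mat l s *v x) \<bullet> gam \<eta>)))" for \<eta>
    unfolding f_def inner_gam_affine e_add using s by (simp add: indicator_def ac_simps)
  have "ext {l + s * a .. l + s * b} g x = (\<integral>\<xi>. f \<xi> \<partial>lborel)"
    by (simp add: ext_def set_lebesgue_integral_def f_def)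
  also have "\<dots> = s *\<^sub>R (\<integral>\<eta>. f (l + s * \<eta>) \<partial>lborel)"
    using s lborel_integral_real_affine[of s f l] by simp
  also have "\<dots> = s *\<^sub>R (e (x \<bullet> gam l) * ext {a..b} (\<lambda>\<eta>. g (l + s * \<eta>)) (rescale_mat l s *v x))"
    by (simp only: f ext_def set_lebesgue_integral_def integral_mult_right_zero)
  finally show ?thesis
    by (simp add: scaleR_conv_of_real)
qed

lemma g_ok_affine:
  assumes g: "g_ok g" and "0 \<le> l" "s > 0" "l + s \<le> 1"
  shows "g_ok (\<lambda>\<eta>. g (l + s * \<eta>))"
proof -
  have "set_integrable lborel {l..l + s} g"
    using g unfolding g_ok_def by (rule set_integrable_subset) (use assms in auto)
  then have "integrable lborel (\<lambda>\<eta>. indicator {l..l + s} (l + s * \<eta>) *\<^sub>R g (l + s * \<eta>))"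
    using \<open>s > 0\<close> unfolding set_integrable_def by (intro lborel_integrable_real_affine) auto
  moreover have "indicator {l..l + s} (l + s * \<eta>) = (indicator {0..1} \<eta> :: real)" for \<eta>
    using \<open>s > 0\<close> by (simp add: indicator_def mult_le_cancel_left1 zero_le_mult_iff)
  ultimately show ?thesis
    by (simp add: g_ok_def set_integrable_def)
qed

text \<open>Parabolic rescaling: \<open>\<bar>det (rescale_mat l s)\<bar> = s\<^sup>6\<close>, so the \<open>L\<^sup>1\<^sup>2\<close> norm scales by \<open>s \<cdot> s\<^bsup>-6/12\<^esup>\<close>.\<close>
lemma L12_ext_affine:
  assumes s: "s > 0" and g: "g_ok (\<lambda>\<eta>. g (l + s * \<eta>))" and ab: "{a..b} \<subseteq> {0..1}"
  shows "L12 (ext {l + s * a .. l + s * b} g)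
    = ennreal (s powr (1/2)) * L12 (ext {a..b} (\<lambda>\<eta>. g (l + s * \<eta>)))"
proof -
  define h where "h y = ennreal (cmod (ext {a..b} (\<lambda>\<eta>. g (l + s * \<eta>)) y) ^ 12)" for y
  have [measurable]: "h \<in> borel_measurable borel"
    using borel_measurable_ext[OF g ab] unfolding h_def by measurable
  have "L12 (ext {l + s * a .. l + s * b} g) ^ 12 = (\<integral>\<^sup>+x. ennreal (s ^ 12) * h (rescale_mat l s *v x) \<partial>lborel)"
    unfolding L12_power_12 h_def using s
    by (intro nn_integral_cong) (simp add: ext_affine norm_mult ennreal_mult'[symmetric] power_mult_distrib)
  also have "\<dots> = ennreal (s ^ 12) * (\<integral>\<^sup>+x. h (rescale_mat l s *v x) \<partial>lborel)"
    by (rule nn_integral_cmult) measurable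
  also have "(\<integral>\<^sup>+x. h (rescale_mat l s *v x) \<partial>lborel) = ennreal (1 / \<bar>det (rescale_mat l s)\<bar>) * (\<integral>\<^sup>+x. h x \<partial>lborel)"
    using s by (intro nn_integral_matrix_vector_mult) (simp_all add: invertible_det_nz det_rescale_mat)
  also have "(\<integral>\<^sup>+x. h x \<partial>lborel) = L12 (ext {a..b} (\<lambda>\<eta>. g (l + s * \<eta>))) ^ 12"
    by (simp add: L12_power_12 h_def)
  also have "\<bar>det (rescale_mat l s)\<bar> = s ^ 6"
    using s by (simp add: det_rescale_mat)
  also have "ennreal (s ^ 12) * (ennreal (1 / s ^ 6) * L12 (ext {a..b} (\<lambda>\<eta>. g (l + s * \<eta>))) ^ 12)
      = (ennreal (s powr (1/2)) * L12 (ext {a..b} (\<lambda>\<eta>. g (l + s * \<eta>)))) ^ 12"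
  proof -
    have "(s powr (1/2)) ^ 12 = s ^ 6"
      using s powr_realpow[of s 6] by (simp add: powr_power)
    then have "s ^ 12 * (1 / s ^ 6) = (s powr (1/2)) ^ 12"
      using s by (simp add: field_simps flip: power_add)
    then show ?thesis
      using s by (simp add: power_mult_distrib ennreal_power mult.assoc[symmetric] ennreal_mult'[symmetric])
  qed
  finally have "enn_powr (1/12) (L12 (ext {l + s * a .. l + s * b} g) ^ 12)
      = enn_powr (1/12) ((ennreal (s powr (1/2)) * L12 (ext {a..b} (\<lambda>\<eta>. g (l + s * \<eta>)))) ^ 12)"
    by (rule arg_cong)
  then show ?thesis
    by (simp add: enn_powr_of_power)
qed

lemma L12_ext_le_of_decoupling:
  assumes g: "g_ok g" and l: "0 \<le> l" "l + s \<le> 1" and s: "s > 0" and \<delta>: "\<delta> > 0" and n: "s / \<delta> = real n"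
    and D: "\<forall>g. g_ok g \<longrightarrow> L12 (ext {0..1} g) \<le> D * enn_powr (1/4) (\<Sum>J\<in>part (\<delta> / s) 0 1. L12 (ext J g) ^ 4)"
  shows "L12 (ext {l..l + s} g)
    \<le> D * enn_powr (1/4) (\<Sum>k<n. L12 (ext {l + real k * \<delta> .. l + (real k + 1) * \<delta>} g) ^ 4)"
proof -
  define \<sigma> where "\<sigma> = \<delta> / s"
  define c where "c = ennreal (s powr (1/2))"
  define h where "h = (\<lambda>\<eta>. g (l + s * \<eta>))"
  define S where "S = (\<Sum>k<n. L12 (ext {real k * \<sigma> .. (real k + 1) * \<sigma>} h) ^ 4)"
  have h: "g_ok h"
    unfolding h_def using g l(1) s l(2) by (rule g_ok_affine)
  have "s = real n * \<delta>"
    using n \<delta> by (simp add: divide_eq_eq)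
  then have \<sigma>: "\<sigma> > 0" "real n * \<sigma> = 1"
    using s \<delta> by (auto simp: \<sigma>_def zero_less_mult_iff)
  have "1 / \<sigma> = real n"
    using \<sigma> by (simp add: divide_eq_eq mult.commute)
  then have decoupled: "L12 (ext {0..1} h) \<le> D * enn_powr (1/4) S"
    using D h \<sigma> by (simp add: S_def sum_part \<sigma>_def[symmetric])
  have pieces: "L12 (ext {l + real k * \<delta> .. l + (real k + 1) * \<delta>} g) = c * L12 (ext {real k * \<sigma> .. (real k + 1) * \<sigma>} h)"
    if "k < n" for k
  proof -
    have "(real k + 1) * \<sigma> \<le> real n * \<sigma>"
      using that \<sigma> by (intro mult_right_mono) auto
    then have "{real k * \<sigma> .. (real k + 1) * \<sigma>} \<subseteq> {0..1}"
      using \<sigma> by auto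
    from L12_ext_affine[OF s h[unfolded h_def] this] show ?thesis
      using s by (simp add: c_def h_def \<sigma>_def algebra_simps)
  qed
  have "L12 (ext {l..l + s} g) = c * L12 (ext {0..1} h)"
    using L12_ext_affine[OF s h[unfolded h_def], of 0 1] by (simp add: c_def h_def)
  also have "\<dots> \<le> c * (D * enn_powr (1/4) S)"
    by (rule mult_left_mono[OF decoupled]) simp
  also have "\<dots> = D * enn_powr (1/4) (c ^ 4 * S)"
    by (simp add: enn_powr_mult enn_powr_of_power mult.left_commute)
  also have "c ^ 4 * S = (\<Sum>k<n. L12 (ext {l + real k * \<delta> .. l + (real k + 1) * \<delta>} g) ^ 4)"
    by (simp add: S_def sum_distrib_left power_mult_distrib pieces)
  finally show ?thesis .
qed

lemma L12_ext_le_Dec: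
  assumes g: "g_ok g" and l: "0 \<le> l" "l + s \<le> 1" and s: "s > 0" and \<delta>: "\<delta> > 0" and n: "s / \<delta> = real n"
  defines "S \<equiv> \<Sum>J\<in>part \<delta> (Inf {l..l + s}) (Sup {l..l + s}). L12 (ext J g) ^ 4"
  assumes S: "0 < S" "S < top"
  shows "L12 (ext {l..l + s} g) \<le> Dec (\<delta> / s) * enn_powr (1/4) S"
proof -
  have "0 < enn_powr (1/4) S" "enn_powr (1/4) S < top"
    using S by (simp_all add: zero_less_iff_neq_zero flip: less_top)
  then have "L12 (ext {l..l + s} g) \<le> Dec (\<delta> / s) ^ 1 * enn_powr (1/4) S"
    unfolding Dec_def S_def sum_part_Icc[OF s \<delta> n]
    by (intro le_Inf_power_mult) (use L12_ext_le_of_decoupling[OF g l s \<delta> n] in auto)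
  then show ?thesis by simp
qed

section \<open>The bilinear estimate\<close>

lemma convI_ext_eq_0:
  assumes g: "g_ok g" and s: "s > 0" and \<delta>: "\<delta> > 0" and n: "s / \<delta> = real n"
    and l: "0 \<le> l" "l + s \<le> 1" and p: "p > 0"
    and zero: "(\<Sum>J\<in>part \<delta> (Inf {l..l + s}) (Sup {l..l + s}). L12 (ext J g) ^ 4) = 0"
  shows "convI (ext {l..l + s} g) p I E x = 0"
proof -
  have ns: "l + real n * \<delta> = l + s"
    using n \<delta> by (simp add: divide_eq_eq)
  have "(\<Sum>k<n. L12 (ext {l + real k * \<delta> .. l + (real k + 1) * \<delta>} g) ^ 4) = 0"
    using zero by (simp only: sum_part_Icc[OF s \<delta> n])
  then have "AE x in lborel. ext {l..l + real n * \<delta>} g x = 0"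
    using l(2) ns by (intro AE_ext_eq_0[OF g l(1) \<delta>]) simp_all
  then have "AE x in lborel. ennreal (cmod (ext {l..l + s} g x) ^ p) = 0"
    unfolding ns by eventually_elim (simp add: p)
  moreover have "ext {l..l + s} g \<in> borel_measurable borel"
    using g l by (intro borel_measurable_ext) auto
  ultimately show ?thesis
    by (intro convI_eq_0) (simp_all add: nn_integral_0_iff_AE)
qed

lemma M1_le:
  assumes "\<And>y g I I'. R < y \<Longrightarrow> g_ok g \<Longrightarrow> I \<in> part (\<nu>^a) 0 1 \<Longrightarrow> I' \<in> part (\<nu>^b) 0 1 \<Longrightarrow>
      \<nu> \<le> setdist I I' \<Longrightarrow>
      (\<integral>\<^sup>+x. convI (ext I g) 2 I E x * convI (ext I' g) 10 I' E x \<partial>lborel)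
      \<le> y ^ 12 * enn_powr (1/2) (\<Sum>J\<in>part \<delta> (Inf I) (Sup I). L12 (ext J g) ^ 4)
          * enn_powr (5/2) (\<Sum>J'\<in>part \<delta> (Inf I') (Sup I'). L12 (ext J' g) ^ 4)"
  shows "M1 a b \<delta> \<nu> E \<le> R"
  unfolding M1_def by (rule dense_ge, rule Inf_lower, intro CollectI allI impI ballI assms)

lemma le_M2:
  fixes \<delta> :: real
  assumes "g_ok g" "I \<in> part (\<nu>^a) 0 1" "I' \<in> part (\<nu>^b) 0 1" "\<nu> \<le> setdist I I'"
  defines "S \<equiv> \<Sum>J\<in>part \<delta> (Inf I) (Sup I). L12 (ext J g) ^ 4"
    and "S' \<equiv> \<Sum>J'\<in>part \<delta> (Inf I') (Sup I'). L12 (ext J' g) ^ 4"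
  assumes "0 < S * S' ^ 2" "S * S' ^ 2 < top"
  shows "(\<integral>\<^sup>+x. convI (ext I g) 4 I E x * convI (ext I' g) 8 I' E x \<partial>lborel) \<le> M2 a b \<delta> \<nu> E ^ 12 * S * S' ^ 2"
  unfolding M2_def mult.assoc using assms by (intro le_Inf_power_mult) auto

lemma nn_integral_convI_ext_le_M2_Dec:
  assumes K: "weight_mass E = ennreal K" "0 \<le> K"
    and \<delta>: "\<delta> > 0" and \<nu>: "\<nu> > 0" and nA: "\<nu> ^ a / \<delta> = real nA" and nB: "\<nu> ^ b / \<delta> = real nB"
    and g: "g_ok g" and I: "I \<in> part (\<nu>^a) 0 1" and I': "I' \<in> part (\<nu>^b) 0 1" and sd: "\<nu> \<le> setdist I I'"
  defines "S \<equiv> \<Sum>J\<in>part \<delta> (Inf I) (Sup I). L12 (ext J g) ^ 4"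
    and "S' \<equiv> \<Sum>J'\<in>part \<delta> (Inf I') (Sup I'). L12 (ext J' g) ^ 4"
  assumes S: "0 < S" "S < top" "0 < S'" "S' < top"
  shows "(\<integral>\<^sup>+x. convI (ext I g) 2 I E x * convI (ext I' g) 10 I' E x \<partial>lborel)
    \<le> (ennreal (K powr (1/8)) * enn_powr (1/4) (M2 b a \<delta> \<nu> E) * enn_powr (3/4) (Dec (\<delta> / \<nu> ^ b))) ^ 12
      * enn_powr (1/2) S * enn_powr (5/2) S'"
proof (rule nn_integral_convI_2_10_le[OF _ _ _ _ K])
  have sa: "\<nu> ^ a > 0" and sb: "\<nu> ^ b > 0"
    using \<nu> by simp_all
  obtain l where I_eq: "I = {l..l + \<nu> ^ a}" and l: "0 \<le> l" "l + \<nu> ^ a \<le> 1"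
    using mem_part_unit_intervalE[OF sa I] .
  obtain l' where I'_eq: "I' = {l'..l' + \<nu> ^ b}" and l': "0 \<le> l'" "l' + \<nu> ^ b \<le> 1"
    using mem_part_unit_intervalE[OF sb I'] .
  show "ext I g \<in> borel_measurable borel" "ext I' g \<in> borel_measurable borel"
    using l l' by (auto simp: I_eq I'_eq intro!: borel_measurable_ext[OF g])
  show "invertible (TA I)" "invertible (TA I')"
    using sa sb by (auto simp: I_eq I'_eq intro!: invertible_TA)
  have "0 < S' * S ^ 2" "S' * S ^ 2 < top"
    using S by (simp_all add: zero_less_iff_neq_zero ennreal_mult_less_top power_less_top_ennreal)
  then show "(\<integral>\<^sup>+x. convI (ext I' g) 4 I' E x * convI (ext I g) 8 I E x \<partial>lborel)
      \<le> M2 b a \<delta> \<nu> E ^ 12 * S' * S ^ 2"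
    using le_M2[OF g I' I, of \<delta> E] sd by (simp add: setdist_sym S_def S'_def)
  have "L12 (ext I' g) \<le> Dec (\<delta> / \<nu> ^ b) * enn_powr (1/4) S'"
    using L12_ext_le_Dec[OF g l' sb \<delta> nB] S by (simp add: S'_def I'_eq)
  then have "L12 (ext I' g) ^ 12 \<le> (Dec (\<delta> / \<nu> ^ b) * enn_powr (1/4) S') ^ 12"
    by (rule power_mono) simp
  then show "(\<integral>\<^sup>+x. ennreal (cmod (ext I' g x) ^ 12) \<partial>lborel) \<le> Dec (\<delta> / \<nu> ^ b) ^ 12 * enn_powr 3 S'"
    by (simp add: L12_power_12 power_mult_distrib enn_powr_power)
qed

text \<open>Comparing with \<open>y > R\<close> rather than with \<open>R\<close> itself keeps \<open>y \<noteq> 0\<close>, which the case of an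
  infinite right-hand side needs.\<close>
lemma M1_bound_for_pair:
  assumes K: "weight_mass E = ennreal K" "0 \<le> K"
    and \<delta>: "\<delta> > 0" and \<nu>: "\<nu> > 0" and nA: "\<nu> ^ a / \<delta> = real nA" and nB: "\<nu> ^ b / \<delta> = real nB"
    and g: "g_ok g" and I: "I \<in> part (\<nu>^a) 0 1" and I': "I' \<in> part (\<nu>^b) 0 1" and sd: "\<nu> \<le> setdist I I'"
    and y: "ennreal (K powr (1/8)) * enn_powr (1/4) (M2 b a \<delta> \<nu> E) * enn_powr (3/4) (Dec (\<delta> / \<nu> ^ b)) < y"
  shows "(\<integral>\<^sup>+x. convI (ext I g) 2 I E x * convI (ext I' g) 10 I' E x \<partial>lborel)
    \<le> y ^ 12 * enn_powr (1/2) (\<Sum>J\<in>part \<delta> (Inf I) (Sup I). L12 (ext J g) ^ 4)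
        * enn_powr (5/2) (\<Sum>J'\<in>part \<delta> (Inf I') (Sup I'). L12 (ext J' g) ^ 4)"
proof -
  define S S' where "S = (\<Sum>J\<in>part \<delta> (Inf I) (Sup I). L12 (ext J g) ^ 4)"
    and "S' = (\<Sum>J'\<in>part \<delta> (Inf I') (Sup I'). L12 (ext J' g) ^ 4)"
  consider "S = 0 \<or> S' = 0" | "S = top \<or> S' = top" "S \<noteq> 0" "S' \<noteq> 0"
    | "0 < S" "S < top" "0 < S'" "S' < top"
    by (auto simp: zero_less_iff_neq_zero simp flip: less_top)
  then show ?thesis
  proof cases
    case 1
    have sa: "\<nu> ^ a > 0" and sb: "\<nu> ^ b > 0"
      using \<nu> by simp_all
    obtain l where I_eq: "I = {l..l + \<nu> ^ a}" and l: "0 \<le> l" "l + \<nu> ^ a \<le> 1"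
      using mem_part_unit_intervalE[OF sa I] .
    obtain l' where I'_eq: "I' = {l'..l' + \<nu> ^ b}" and l': "0 \<le> l'" "l' + \<nu> ^ b \<le> 1"
      using mem_part_unit_intervalE[OF sb I'] .
    have "(\<lambda>x. convI (ext I g) 2 I E x * convI (ext I' g) 10 I' E x) = (\<lambda>_. 0)"
      using 1 convI_ext_eq_0[OF g sa \<delta> nA l, of 2] convI_ext_eq_0[OF g sb \<delta> nB l', of 10]
      by (intro ext) (auto simp: S_def S'_def I_eq I'_eq)
    then show ?thesis by simp
  next
    case 2
    moreover have "y \<noteq> 0"
      using y by auto
    ultimately have "y ^ 12 * enn_powr (1/2) S * enn_powr (5/2) S' = top"
      by (auto simp: ennreal_mult_top ennreal_top_mult)
    then show ?thesis by (simp add: S_def S'_def)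
  next
    case 3
    then have "(\<integral>\<^sup>+x. convI (ext I g) 2 I E x * convI (ext I' g) 10 I' E x \<partial>lborel)
        \<le> (ennreal (K powr (1/8)) * enn_powr (1/4) (M2 b a \<delta> \<nu> E) * enn_powr (3/4) (Dec (\<delta> / \<nu> ^ b))) ^ 12
          * enn_powr (1/2) S * enn_powr (5/2) S'"
      unfolding S_def S'_def by (rule nn_integral_convI_ext_le_M2_Dec[OF K \<delta> \<nu> nA nB g I I' sd])
    also have "\<dots> \<le> y ^ 12 * enn_powr (1/2) S * enn_powr (5/2) S'"
      using y by (intro mult_right_mono power_mono) simp_all
    finally show ?thesis by (simp add: S_def S'_def)
  qed
qed

lemma M1_le_M2_Dec:
  assumes E: "6 \<le> E" and "\<delta> \<in> Ninv" "\<nu> \<in> Ninv" "\<nu> ^ a / \<delta> \<in> \<nat>" "\<nu> ^ b / \<delta> \<in> \<nat>"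
  shows "M1 a b \<delta> \<nu> E
    \<le> ennreal (enn2real (weight_mass E) powr (1/8)) * enn_powr (1/4) (M2 b a \<delta> \<nu> E) * enn_powr (3/4) (Dec (\<delta> / \<nu> ^ b))"
proof -
  have "\<delta> > 0" "\<nu> > 0"
    using assms(2,3) by (auto simp: Ninv_def)
  moreover obtain nA nB where "\<nu> ^ a / \<delta> = real nA" "\<nu> ^ b / \<delta> = real nB"
    using assms(4,5) by (auto elim!: Nats_cases)
  moreover have "weight_mass E = ennreal (enn2real (weight_mass E))"
    using weight_mass_finite[OF E] by (simp add: less_top)
  ultimately show ?thesis
    by (intro M1_le M1_bound_for_pair) auto
qed

theorem lemma2p5:
  shows "\<exists>C0::real. C0 > 0 \<and>
    (\<forall>E::real. E > 1000 \<longrightarrow> (\<exists>CE::real. \<forall>(a::nat) (b::nat) (\<delta>::real) (\<nu>::real).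
       a > 0 \<longrightarrow> b > 0 \<longrightarrow> \<delta> \<in> Ninv \<longrightarrow> \<nu> \<in> Ninv \<longrightarrow>
       \<nu> ^ a / \<delta> \<in> \<nat> \<longrightarrow> \<nu> ^ b / \<delta> \<in> \<nat> \<longrightarrow>
       M1 a b \<delta> \<nu> E \<le> ennreal CE * enn_powr (1/4) (M2 b a \<delta> \<nu> (E / C0))
                            * enn_powr (3/4) (Dec (\<delta> / \<nu> ^ b))))"
  by (rule exI[of _ 1])
     (auto intro!: exI[where x = "enn2real (weight_mass E) powr (1/8)" for E] M1_le_M2_Dec)

end
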